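(* Let $\mathcal X\subseteq\mathbb R^p$ be a compact set with $\max_{x\in\mathcal X}\|x\|_\infty=\bar X$. Let $L_0>0$ and $M_0>0$. Then for every $f_0\in\mathcal F_{L_0,M_0}$, every $K\in\mathbb N$ (with $K\ge 1$) and every $\mu\ge\max\{\tfrac12 L_0K^{1/p},\ \tfrac14 pL_0\bar XK^{1/p}+\tfrac12M_0\}$, one has $$\min_{f\in\mathcal H_\mu^K}\|f-f_0\|_\infty\le 2(p^{1/2}+3)\,p^{1/2}L_0\bar XK^{-1/p}.$$
   Context: $\|\cdot\|$ without subscript is the Euclidean norm and $[K]=\{1,\dots,K\}$. For $f:\mathcal X\to\mathbb R^d$, $\|f\|_\infty=\sup_{x\in\mathcal X}\max_{\iota\in[d]}|f_\iota(x)|$. For $L,M>0$, $\mathcal F_{L,M}=\{f:\mathcal X\to\mathbb R^d \mid \|f\|_\infty\le M,\ f \text{ is } L\text{-Lipschitz continuous}\}$. For $K\in\mathbb N$, $\mu>0$, the class $\mathcal H_\mu^K$ of piecewise affine decision rules consists of all functions $f=(f_\iota(\cdot,\theta_\iota))_{\iota=1}^d:\mathcal X\to\mathbb R^d$ with $$f_\iota(x,\theta_\iota)=\max_{k\in[K]}\{(\alpha_\iota^k)^\top x+a_\iota^k\}-\max_{k\in[K]}\{(\beta_\iota^k)^\top x+b_\iota^k\},$$ where $\theta_\iota=(\alpha_\iota^k,a_\iota^k,\beta_\iota^k,b_\iota^k)_{k=1}^K\in\mathbb R^{2K(p+1)}$ and $\|\theta_\iota\|_\infty\le\mu$ for all $\iota\in[d]$.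 *)

theory Defs
  imports "HOL-Analysis.Analysis"
begin

text \<open>
  A function on \<open>X\<close> with values in \<open>\<real>\<^sup>d\<close> is represented by a total function of which only
  the values on \<open>X\<close> matter. The real-valued supremum below is meaningful when \<open>X\<close> is nonempty
  and \<open>f\<close> is bounded on \<open>X\<close>; on a nonempty compact \<open>X\<close> this covers all Lipschitz functions
  and all piecewise affine decision rules (see \<open>sup_norm_le_iff\<close>).
\<close>

definition sup_norm :: "(real ^ 'p) set \<Rightarrow> (real ^ 'p \<Rightarrow> real ^ 'd) \<Rightarrow> real" where
  "sup_norm X f = (SUP x\<in>X. infnorm (f x))"

lemma sup_norm_le_iff:
  fixes f :: "real ^ 'p \<Rightarrow> real ^ 'd"
  assumes "compact X" "X \<noteq> {}" "continuous_on X f"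
  shows "sup_norm X f \<le> M \<longleftrightarrow> (\<forall>x\<in>X. \<forall>\<iota>. \<bar>f x $ \<iota>\<bar> \<le> M)"
proof -
  have "continuous_on X (\<lambda>x. infnorm (f x))"
    using assms(3) by (rule continuous_on_infnorm)
  then have "bdd_above ((\<lambda>x. infnorm (f x)) ` X)"
    using assms(1) by (intro bounded_imp_bdd_above compact_imp_bounded compact_continuous_image)
  then have "sup_norm X f \<le> M \<longleftrightarrow> (\<forall>x\<in>X. infnorm (f x) \<le> M)"
    unfolding sup_norm_def using assms(2) by (intro cSUP_le_iff)
  moreover have "infnorm y \<le> M \<longleftrightarrow> (\<forall>\<iota>. \<bar>y $ \<iota>\<bar> \<le> M)" for y :: "real ^ 'd"
  proof -
    have "infnorm y = Sup (range (\<lambda>\<iota>. \<bar>y $ \<iota>\<bar>))"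
      by (simp add: infnorm_cart full_SetCompr_eq)
    then show ?thesis by (simp add: cSup_le_iff)
  qed
  ultimately show ?thesis by blast
qed

definition lipschitz_class ::
  "(real ^ 'p) set \<Rightarrow> real \<Rightarrow> real \<Rightarrow> (real ^ 'p \<Rightarrow> real ^ 'd) set" where
  "lipschitz_class X L M = {f. sup_norm X f \<le> M \<and> L-lipschitz_on X f}"

text \<open>
  The parameter \<open>\<theta>\<^sub>\<iota>\<close> of one component; only the indices in \<open>{1..K}\<close> are used,
  and \<open>\<theta>\<^sub>\<iota> k\<close> is the quadruple of \<open>\<alpha>\<^sup>k\<close>, \<open>a\<^sup>k\<close>, \<open>\<beta>\<^sup>k\<close>, \<open>b\<^sup>k\<close>.
\<close>

type_synonym 'p param = "nat \<Rightarrow> (real ^ 'p) \<times> real \<times> (real ^ 'p) \<times> real"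

text \<open>The maximum norm of \<open>\<theta>\<^sub>\<iota>\<close> as a vector of \<open>2K(p+1)\<close> reals, for \<open>K \<ge> 1\<close>.\<close>

definition param_norm :: "nat \<Rightarrow> ('p::finite) param \<Rightarrow> real" where
  "param_norm K \<theta> = (MAX k\<in>{1..K}. case \<theta> k of (\<alpha>, a, \<beta>, b) \<Rightarrow>
     Max {infnorm \<alpha>, \<bar>a\<bar>, infnorm \<beta>, \<bar>b\<bar>})"

definition pw_affine :: "nat \<Rightarrow> ('p::finite) param \<Rightarrow> real ^ 'p \<Rightarrow> real" where
  "pw_affine K \<theta> x =
     (MAX k\<in>{1..K}. case \<theta> k of (\<alpha>, a, \<beta>, b) \<Rightarrow> \<alpha> \<bullet> x + a)
   - (MAX k\<in>{1..K}. case \<theta> k of (\<alpha>, a, \<beta>, b) \<Rightarrow> \<beta> \<bullet> x + b)"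

definition pw_affine_class ::
  "(real ^ 'p) set \<Rightarrow> nat \<Rightarrow> real \<Rightarrow> (real ^ 'p \<Rightarrow> real ^ 'd) set" where
  "pw_affine_class X K \<mu> =
     {f. \<exists>\<theta> :: 'd \<Rightarrow> ('p::finite) param.
           (\<forall>\<iota>. param_norm K (\<theta> \<iota>) \<le> \<mu>) \<and>
           (\<forall>x\<in>X. \<forall>\<iota>. f x $ \<iota> = pw_affine K (\<theta> \<iota>) x)}"

end

theory Submission
  imports Defs
begin

text \<open>
  Why the bound holds. Fix one component \<open>f\<close> of \<open>f\<^sub>0\<close>, points \<open>z\<^sub>1, \<dots>, z\<^sub>K\<close> and \<open>c \<ge> 0\<close>. Since
  \<open>2c z\<^sub>k \<bullet> x - c |z\<^sub>k|\<^sup>2 = c |x|\<^sup>2 - c |x - z\<^sub>k|\<^sup>2\<close>, the affine functions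
  \<open>2c z\<^sub>k \<bullet> x + (w\<^sub>k - c |z\<^sub>k|\<^sup>2)\<close> are, up to the common summand \<open>c |x|\<^sup>2\<close>, the penalised values
  \<open>w\<^sub>k - c |x - z\<^sub>k|\<^sup>2\<close>. If \<open>w\<^sub>k\<close> is the value at \<open>z\<^sub>k\<close> of a Lipschitz function, the maximum over
  \<open>k\<close> therefore follows that function: the penalty keeps far points from winning, and a near point
  loses little. Doing this with \<open>w\<^sub>k = f(z\<^sub>k)/2\<close> and with \<open>w\<^sub>k = -f(z\<^sub>k)/2\<close> and subtracting, the
  summand \<open>c |x|\<^sup>2\<close> cancels and \<open>f\<close> remains (\<open>penalised_max_close\<close>, \<open>pw_affine_close\<close>).
  Halving \<open>f\<close> in this way is what lets the intercepts fit under a bound containing \<open>M\<^sub>0 / 2\<close>.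

  For an \<open>L\<close>-Lipschitz \<open>f\<close> and points \<open>z\<^sub>k\<close> that come within \<open>\<delta>\<close> of every point of \<open>X\<close>, the error
  is at most \<open>L\<^sup>2 / (16c) + L\<delta>/2 + c \<delta>\<^sup>2\<close>. The midpoints of a cubic grid on \<open>[-X_bar, X_bar]\<^sup>p\<close> with
  \<open>\<lfloor>K\<^bsup>1/p\<^esup>\<rfloor>\<close> cells per axis give \<open>\<delta> = 2 \<surd>p X_bar K\<^bsup>-1/p\<^esup>\<close> (\<open>cube_net\<close>). The admissible bounds
  on slopes and intercepts suggest \<open>c = L K\<^bsup>1/p\<^esup> / (4 X_bar)\<close>, and the error becomes
  \<open>(1/4 + \<surd>p + p) L X_bar K\<^bsup>-1/p\<^esup>\<close>, which is at most the required bound. The midpoints need not lie in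
  \<open>X\<close>; there \<open>f\<close> is replaced by a bounded Lipschitz extension (\<open>lipschitz_bounded_value\<close>).

  Why the minimum is attained. The admissible parameters form a product of compact boxes, and for a
  continuous target the condition that the uniform error is at most \<open>t\<close> is closed in the parameters,
  because at each point of \<open>X\<close> the decision rule depends continuously on them
  (\<open>lower_semicontinuous_attains_inf\<close>, \<open>pw_affine_class_minimizer\<close>).
\<close>

section \<open>Existence of a best approximation\<close>

lemma infnorm_cart_le_iff:
  fixes y :: "real ^ 'n"
  shows "infnorm y \<le> M \<longleftrightarrow> (\<forall>i. \<bar>y $ i\<bar> \<le> M)"
proof -
  have "infnorm y = Sup (range (\<lambda>i. \<bar>y $ i\<bar>))"
    by (simp add: infnorm_cart full_SetCompr_eq)
  then show ?thesis by (simp add: cSup_le_iff)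
qed

lemma sup_norm_cong:
  "(\<And>x. x \<in> X \<Longrightarrow> f x = g x) \<Longrightarrow> sup_norm X f = sup_norm X g"
  unfolding sup_norm_def by (rule SUP_cong) auto

lemma param_norm_le_iff:
  assumes "K \<ge> 1"
  shows "param_norm K \<theta> \<le> \<mu> \<longleftrightarrow>
    (\<forall>k\<in>{1..K}. \<theta> k \<in> {\<alpha>. infnorm \<alpha> \<le> \<mu>} \<times> {-\<mu>..\<mu>} \<times> {\<alpha>. infnorm \<alpha> \<le> \<mu>} \<times> {-\<mu>..\<mu>})"
  unfolding param_norm_def using assms
  by (subst Max_le_iff) (auto simp: split_beta mem_Times_iff abs_le_iff minus_le_iff)

lemma continuous_on_Max_family:
  fixes h :: "'i \<Rightarrow> 'a::topological_space \<Rightarrow> real"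
  assumes "finite A" "A \<noteq> {}" "\<And>k. k \<in> A \<Longrightarrow> continuous_on S (h k)"
  shows "continuous_on S (\<lambda>x. MAX k\<in>A. h k x)"
  using assms
proof (induction A rule: finite_ne_induct)
  case (insert k A)
  then have "continuous_on S (\<lambda>x. max (h k x) (MAX k\<in>A. h k x))"
    by (intro continuous_on_max) auto
  then show ?case using insert by simp
qed auto

lemma continuous_on_pw_affine:
  assumes "K \<ge> 1"
  shows "continuous_on X (pw_affine K \<theta>)"
proof -
  have "continuous_on X (\<lambda>x. pw_affine K \<theta> x)"
    unfolding pw_affine_def split_beta
    by (intro continuous_on_diff continuous_on_Max_family continuous_intros) (use assms in auto)
  then show ?thesis .
qed

lemma continuous_on_pw_affine_param:
  fixes x :: "real ^ 'p"
  assumes "K \<ge> 1"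
  shows "continuous_on UNIV (\<lambda>\<theta> :: 'd \<Rightarrow> 'p param. pw_affine K (\<theta> \<iota>) x)"
proof -
  have proj: "continuous_on UNIV (\<lambda>\<theta> :: 'd \<Rightarrow> 'p param. \<theta> \<iota> k)" for k
    by (rule continuous_on_product_then_coordinatewise[OF continuous_on_product_coordinates])
  show ?thesis
    unfolding pw_affine_def split_beta
    by (intro continuous_on_diff continuous_on_Max_family continuous_on_add continuous_on_inner
          continuous_on_fst continuous_on_snd continuous_on_const proj) (use assms in auto)
qed

lemma compact_infnorm_ball: "compact {\<alpha> :: real ^ 'n. infnorm \<alpha> \<le> r}"
proof -
  have "{\<alpha> :: real ^ 'n. infnorm \<alpha> \<le> r} = cbox (\<chi> i. -r) (\<chi> i. r)"
    by (auto simp: infnorm_cart_le_iff mem_box_cart abs_le_iff minus_le_iff)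
  then show ?thesis by simp
qed

lemma compact_PiE_UNIV:
  fixes B :: "'i \<Rightarrow> 'a::topological_space set"
  assumes "\<And>i. compact (B i)"
  shows "compact (PiE UNIV B)"
  using compactin_PiE[of "\<lambda>_. euclidean" UNIV B] assms
  by (simp add: euclidean_product_topology)

text \<open>
  The sublevel sets at the values of \<open>J\<close> form a chain of relatively closed nonempty sets, so they
  have a common point. They are described as traces of closed sets \<open>T\<close> of the ambient space because
  in a space that is not Hausdorff a compact \<open>C\<close> may fail to be closed.
\<close>
lemma lower_semicontinuous_attains_inf:
  fixes J :: "'a::topological_space \<Rightarrow> real"
  assumes "compact C"
    and closed_sublevel: "\<And>t. \<exists>T. closed T \<and> C \<inter> T = {c \<in> C. J c \<le> t}"
    and "C \<noteq> {}"
  shows "\<exists>c\<in>C. \<forall>d\<in>C. J c \<le> J d"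
proof -
  obtain T where T: "\<And>t. closed (T t)" "\<And>t. C \<inter> T t = {c \<in> C. J c \<le> t}"
    using closed_sublevel by metis
  have "C \<inter> (\<Inter>d\<in>C. T (J d)) \<noteq> {}"
  proof (rule compact_imp_fip_image[OF \<open>compact C\<close>])
    fix I' assume I': "finite I'" "I' \<subseteq> C"
    show "C \<inter> (\<Inter>d\<in>I'. T (J d)) \<noteq> {}"
    proof (cases "I' = {}")
      case False
      then obtain m where m: "m \<in> I'" "\<And>d. d \<in> I' \<Longrightarrow> J m \<le> J d"
        using I'(1) by (metis arg_min_if_finite(1) arg_min_least)
      have "m \<in> T (J d)" if "d \<in> I'" for d
        using T(2)[of "J d"] m that I'(2) by blast
      then show ?thesis using m(1) I'(2) by blast
    qed (use \<open>C \<noteq> {}\<close> in auto)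
  qed (use T in auto)
  then obtain c where c: "c \<in> C" "\<And>d. d \<in> C \<Longrightarrow> c \<in> T (J d)" by blast
  then have "J c \<le> J d" if "d \<in> C" for d
    using T(2)[of "J d"] that by blast
  with c(1) show ?thesis by blast
qed

theorem pw_affine_class_minimizer:
  fixes X :: "(real ^ 'p) set" and f\<^sub>0 :: "real ^ 'p \<Rightarrow> real ^ 'd"
  assumes "compact X" "X \<noteq> {}" "continuous_on X f\<^sub>0" "K \<ge> 1" "\<mu> \<ge> 0"
  shows "\<exists>f \<in> pw_affine_class X K \<mu>. \<forall>g \<in> pw_affine_class X K \<mu>.
           sup_norm X (\<lambda>x. f x - f\<^sub>0 x) \<le> sup_norm X (\<lambda>x. g x - f\<^sub>0 x)"
proof -
  define B :: "((real ^ 'p) \<times> real \<times> (real ^ 'p) \<times> real) set"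
    where "B = {\<alpha>. infnorm \<alpha> \<le> \<mu>} \<times> {-\<mu>..\<mu>} \<times> {\<alpha>. infnorm \<alpha> \<le> \<mu>} \<times> {-\<mu>..\<mu>}"
  \<comment> \<open>Parameters with index outside \<open>{1..K}\<close> are irrelevant, but have to range over a compact set too.\<close>
  define C :: "('d \<Rightarrow> 'p param) set" where "C = (UNIV \<rightarrow>\<^sub>E (UNIV \<rightarrow>\<^sub>E B))"
  define F :: "('d \<Rightarrow> 'p param) \<Rightarrow> real ^ 'p \<Rightarrow> real ^ 'd"
    where "F = (\<lambda>\<theta> x. \<chi> \<iota>. pw_affine K (\<theta> \<iota>) x)"
  define J where "J = (\<lambda>\<theta>. sup_norm X (\<lambda>x. F \<theta> x - f\<^sub>0 x))"
  have "compact B"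
    unfolding B_def by (intro compact_Times compact_infnorm_ball) auto
  then have "compact C"
    unfolding C_def by (intro compact_PiE_UNIV)
  have "0 \<in> B"
    unfolding B_def zero_prod_def using \<open>\<mu> \<ge> 0\<close> by (auto simp: infnorm_0)
  then have "C \<noteq> {}"
    unfolding C_def by (auto simp: PiE_eq_empty_iff)
  have J_le: "J \<theta> \<le> t \<longleftrightarrow> (\<forall>x\<in>X. \<forall>\<iota>. \<bar>pw_affine K (\<theta> \<iota>) x - f\<^sub>0 x $ \<iota>\<bar> \<le> t)" for \<theta> t
  proof -
    have "continuous_on X (\<lambda>x. F \<theta> x - f\<^sub>0 x)"
      unfolding F_def
      by (intro continuous_on_diff assms continuous_on_vec_lambda continuous_on_pw_affine)
    from sup_norm_le_iff[OF assms(1,2) this] show ?thesis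
      by (simp add: J_def F_def)
  qed
  have "\<exists>\<theta>\<in>C. \<forall>\<eta>\<in>C. J \<theta> \<le> J \<eta>"
  proof (rule lower_semicontinuous_attains_inf[OF \<open>compact C\<close> _ \<open>C \<noteq> {}\<close>])
    fix t
    define T where "T = (\<Inter>x\<in>X. \<Inter>\<iota>. {\<theta> :: 'd \<Rightarrow> 'p param. \<bar>pw_affine K (\<theta> \<iota>) x - f\<^sub>0 x $ \<iota>\<bar> \<le> t})"
    have "closed T"
      unfolding T_def
      by (intro closed_INT ballI closed_Collect_le continuous_intros
            continuous_on_pw_affine_param assms)
    moreover have "C \<inter> T = {\<theta> \<in> C. J \<theta> \<le> t}"
      by (auto simp: T_def J_le)
    ultimately show "\<exists>T. closed T \<and> C \<inter> T = {\<theta> \<in> C. J \<theta> \<le> t}" by blast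
  qed
  then obtain \<theta> where \<theta>: "\<theta> \<in> C" "\<And>\<eta>. \<eta> \<in> C \<Longrightarrow> J \<theta> \<le> J \<eta>" by blast
  have "param_norm K (\<theta> \<iota>) \<le> \<mu>" for \<iota>
    using \<theta>(1) unfolding param_norm_le_iff[OF \<open>K \<ge> 1\<close>] C_def B_def[symmetric] by auto
  then have "F \<theta> \<in> pw_affine_class X K \<mu>"
    unfolding pw_affine_class_def F_def by auto
  moreover have "sup_norm X (\<lambda>x. F \<theta> x - f\<^sub>0 x) \<le> sup_norm X (\<lambda>x. g x - f\<^sub>0 x)"
    if "g \<in> pw_affine_class X K \<mu>" for g
  proof -
    from that obtain \<eta> where "(\<forall>\<iota>. param_norm K (\<eta> \<iota>) \<le> \<mu>) \<and>
        (\<forall>x\<in>X. \<forall>\<iota>. g x $ \<iota> = pw_affine K (\<eta> \<iota>) x)"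
      unfolding pw_affine_class_def mem_Collect_eq by (elim exE)
    then have \<eta>: "param_norm K (\<eta> \<iota>) \<le> \<mu>"
      and g: "x \<in> X \<Longrightarrow> g x $ \<iota> = pw_affine K (\<eta> \<iota>) x" for x \<iota>
      by auto
    define \<eta>' where "\<eta>' = (\<lambda>\<iota> k. if k \<in> {1..K} then \<eta> \<iota> k else 0)"
    have "\<eta>' \<in> C"
      using \<eta> \<open>0 \<in> B\<close> unfolding param_norm_le_iff[OF \<open>K \<ge> 1\<close>] C_def B_def[symmetric] \<eta>'_def
      by auto
    then have "J \<theta> \<le> J \<eta>'" by (rule \<theta>(2))
    moreover have "pw_affine K (\<eta>' \<iota>) x = pw_affine K (\<eta> \<iota>) x" for \<iota> x
      unfolding pw_affine_def \<eta>'_def by (simp cong: image_cong_simp)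
    then have "J \<eta>' = sup_norm X (\<lambda>x. g x - f\<^sub>0 x)"
      unfolding J_def by (intro sup_norm_cong) (simp add: F_def vec_eq_iff g)
    ultimately show ?thesis by (simp add: J_def)
  qed
  ultimately show ?thesis by blast
qed

section \<open>A net of \<open>K\<close> points in a cube\<close>

lemma interval_net:
  fixes a :: real
  assumes "N \<ge> 1" "a \<ge> 0"
  shows "\<exists>S. finite S \<and> card S \<le> N \<and> S \<subseteq> {-a..a} \<and> (\<forall>t\<in>{-a..a}. \<exists>s\<in>S. \<bar>t - s\<bar> \<le> a / N)"
proof (cases "a = 0")
  case True
  then show ?thesis using assms by (intro exI[of _ "{0}"]) auto
next
  case False
  with assms have a: "a > 0" by simp
  define m where "m = (\<lambda>j::nat. (2 * real j + 1) * a / N - a)"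
  have "m ` {..<N} \<subseteq> {-a..a}"
  proof clarify
    fix j assume "j < N"
    then have "(2 * real j + 1) * a \<le> (2 * real N) * a"
      using a by (intro mult_right_mono) auto
    then have "0 \<le> (2 * real j + 1) * a / N" "(2 * real j + 1) * a / N \<le> 2 * a"
      using a \<open>j < N\<close> by (simp_all add: pos_divide_le_eq algebra_simps)
    then show "m j \<in> {-a..a}" by (simp add: m_def)
  qed
  moreover have "\<exists>s\<in>m ` {..<N}. \<bar>t - s\<bar> \<le> a / N" if t: "t \<in> {-a..a}" for t
  proof -
    define q where "q = (t + a) * N / (2 * a)"
    have "(t + a) * N \<le> (2 * a) * N"
      using t by (intro mult_right_mono) auto
    then have q: "0 \<le> q" "q \<le> N"
      using t a by (simp_all add: q_def pos_divide_le_eq mult.commute)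
    have tq: "t = 2 * q * a / N - a"
      using a assms(1) by (simp add: q_def)
    \<comment> \<open>At the right end point \<open>t = a\<close> the cell index \<open>\<lfloor>q\<rfloor>\<close> would be \<open>N\<close>, hence the minimum.\<close>
    define j where "j = min (nat \<lfloor>q\<rfloor>) (N - 1)"
    have "real j \<le> q" "q \<le> real j + 1" "j < N"
      using q assms(1) by (auto simp: j_def min_def) linarith+
    then have "\<bar>2 * q - (2 * real j + 1)\<bar> \<le> 1" by linarith
    then have "\<bar>2 * q - (2 * real j + 1)\<bar> * (a / N) \<le> 1 * (a / N)"
      using a by (intro mult_right_mono) auto
    moreover have "t - m j = (2 * q - (2 * real j + 1)) * (a / N)"
      by (simp add: tq m_def algebra_simps diff_divide_distrib add_divide_distrib)
    ultimately have "\<bar>t - m j\<bar> \<le> a / N"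
      using a by (simp add: abs_mult)
    with \<open>j < N\<close> show ?thesis by blast
  qed
  ultimately show ?thesis
    by (intro exI[of _ "m ` {..<N}"]) (auto intro: order.trans[OF card_image_le])
qed

text \<open>
  Rounding \<open>K\<^bsup>1/p\<^esup> \<ge> 1\<close> down at most halves it, which is where the factor 2 in the radius comes from.
\<close>
lemma cube_net:
  fixes a :: real
  assumes "K \<ge> 1" "a \<ge> 0"
  shows "\<exists>z :: nat \<Rightarrow> real ^ 'p. (\<forall>k\<in>{1..K}. infnorm (z k) \<le> a) \<and>
    (\<forall>x. infnorm x \<le> a \<longrightarrow> (\<exists>k\<in>{1..K}.
       norm (x - z k) \<le> 2 * sqrt CARD('p) * a / real K powr (1 / CARD('p))))"
proof -
  define s where "s = real K powr (1 / CARD('p))"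
  have s: "s \<ge> 1"
    using assms(1) by (simp add: s_def ge_one_powr_ge_zero)
  define N where "N = nat \<lfloor>s\<rfloor>"
  have N: "N \<ge> 1" "real N \<le> s" "s < real N + 1"
    using s by (auto simp: N_def le_nat_floor)
  have "real N ^ CARD('p) \<le> s ^ CARD('p)"
    using N by (intro power_mono) auto
  also have "\<dots> = K"
    using assms(1) by (simp add: s_def powr_power)
  finally have NK: "N ^ CARD('p) \<le> K"
    by (simp flip: of_nat_power)
  obtain S where S: "finite S" "card S \<le> N" "S \<subseteq> {-a..a}"
      and near: "\<And>t. t \<in> {-a..a} \<Longrightarrow> \<exists>s\<in>S. \<bar>t - s\<bar> \<le> a / N"
    using interval_net[OF N(1) assms(2)] by metis
  define Z where "Z = (vec_lambda :: ('p \<Rightarrow> real) \<Rightarrow> real ^ 'p) ` (UNIV \<rightarrow>\<^sub>E S)"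
  have "finite Z"
    unfolding Z_def using S(1) by (intro finite_imageI finite_PiE) auto
  have "card Z \<le> card ((UNIV :: 'p set) \<rightarrow>\<^sub>E S)"
    unfolding Z_def using S(1) by (intro card_image_le finite_PiE) auto
  also have "\<dots> = card S ^ CARD('p)"
    by (simp add: card_funcsetE)
  also have "\<dots> \<le> K"
    using power_mono[OF S(2), of "CARD('p)"] NK by (meson order.trans zero_le)
  finally have "card Z \<le> K" .
  have Z_near: "\<exists>z\<in>Z. norm (x - z) \<le> 2 * sqrt CARD('p) * a / s" if x: "infnorm x \<le> a" for x
  proof -
    have "\<forall>i. \<exists>t\<in>S. \<bar>x $ i - t\<bar> \<le> a / N"
      using x near by (auto simp: infnorm_cart_le_iff abs_le_iff minus_le_iff)
    then obtain y where y: "\<And>i. y i \<in> S" "\<And>i. \<bar>x $ i - y i\<bar> \<le> a / N"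
      by metis
    have "norm (x - vec_lambda y) \<le> sqrt DIM(real ^ 'p) * infnorm (x - vec_lambda y)"
      by (rule norm_le_infnorm)
    also have "\<dots> \<le> sqrt CARD('p) * (a / N)"
      using y(2) by (intro mult_mono) (auto simp: infnorm_cart_le_iff infnorm_pos_le)
    also have "a / N \<le> 2 * a / s"
    proof -
      have "a * s \<le> a * (2 * N)"
        using N assms(2) by (intro mult_left_mono) linarith+
      then show ?thesis using N(1) s by (simp add: field_simps)
    qed
    finally have "norm (x - vec_lambda y) \<le> sqrt CARD('p) * (2 * a / s)"
      by (simp add: mult_left_mono)
    then have "norm (x - vec_lambda y) \<le> 2 * sqrt CARD('p) * a / s"
      by (simp add: mult_ac)
    moreover have "vec_lambda y \<in> Z"
      unfolding Z_def using y(1) by blast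
    ultimately show ?thesis by blast
  qed
  have "Z \<noteq> {}"
    using Z_near[of 0] assms(2) by (auto simp: infnorm_0)
  \<comment> \<open>If \<open>Z\<close> has fewer than \<open>K\<close> points, the enumeration repeats some of them.\<close>
  obtain e where e: "bij_betw e {1..card Z} Z"
    using ex_bij_betw_nat_finite_1[OF \<open>finite Z\<close>] by blast
  define z where "z = (\<lambda>k. if k \<in> {1..card Z} then e k else SOME y. y \<in> Z)"
  have zZ: "z k \<in> Z" for k
    using e \<open>Z \<noteq> {}\<close> by (auto simp: z_def bij_betw_def some_in_eq)
  have "infnorm y \<le> a" if "y \<in> Z" for y
    using that S(3) by (fastforce simp: Z_def infnorm_cart_le_iff abs_le_iff minus_le_iff)
  then have infnorm_z: "\<forall>k\<in>{1..K}. infnorm (z k) \<le> a"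
    using zZ by blast
  have Z_enum: "\<exists>k\<in>{1..K}. z k = y" if "y \<in> Z" for y
  proof -
    have "y \<in> e ` {1..card Z}"
      using bij_betw_imp_surj_on[OF e] that by simp
    then obtain k where k: "k \<in> {1..card Z}" "y = e k" by (rule imageE)
    from k(1) \<open>card Z \<le> K\<close> have "k \<in> {1..K}" by simp
    moreover have "z k = y" using k by (simp add: z_def)
    ultimately show ?thesis by (rule bexI[rotated])
  qed
  have "\<exists>k\<in>{1..K}. norm (x - z k) \<le> 2 * sqrt CARD('p) * a / s" if x: "infnorm x \<le> a" for x
  proof -
    obtain y where "y \<in> Z" and y: "norm (x - y) \<le> 2 * sqrt CARD('p) * a / s"
      using Z_near[OF x] by blast
    from Z_enum[OF this(1)] obtain k where "k \<in> {1..K}" "z k = y" by blast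
    with y show ?thesis by (intro bexI[of _ k]) simp_all
  qed
  with infnorm_z show ?thesis
    unfolding s_def by (intro exI[of _ z]) simp
qed

section \<open>Approximating a Lipschitz function by penalised maxima\<close>

text \<open>
  This is the value at \<open>z\<close> of the smallest \<open>L\<close>-Lipschitz extension of \<open>f\<close> from \<open>X\<close>, the
  McShane extension, cut off from below at \<open>-M\<close>.
\<close>
lemma lipschitz_bounded_value:
  fixes f :: "'a::real_normed_vector \<Rightarrow> real"
  assumes "X \<noteq> {}" and lip: "\<And>x y. x \<in> X \<Longrightarrow> y \<in> X \<Longrightarrow> \<bar>f x - f y\<bar> \<le> L * norm (x - y)"
    and M: "\<And>x. x \<in> X \<Longrightarrow> \<bar>f x\<bar> \<le> M" and "L \<ge> 0"
  shows "\<exists>v. \<bar>v\<bar> \<le> M \<and> (\<forall>x\<in>X. \<bar>v - f x\<bar> \<le> L * norm (x - z))"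
proof -
  define w where "w = (SUP y\<in>X. f y - L * norm (y - z))"
  have le_M: "f y - L * norm (y - z) \<le> M" if "y \<in> X" for y
    using M[OF that] mult_nonneg_nonneg[OF \<open>L \<ge> 0\<close> norm_ge_zero, of "y - z"] by linarith
  have "w \<le> M"
    unfolding w_def using \<open>X \<noteq> {}\<close> le_M by (intro cSUP_least)
  have lower: "f x - L * norm (x - z) \<le> w" if "x \<in> X" for x
    unfolding w_def using that le_M by (intro cSUP_upper bdd_aboveI2)
  have upper: "w \<le> f x + L * norm (x - z)" if "x \<in> X" for x
    unfolding w_def
  proof (intro cSUP_least \<open>X \<noteq> {}\<close>)
    fix y assume "y \<in> X"
    have "norm (x - y) \<le> norm (x - z) + norm (y - z)"
      using norm_triangle_ineq4[of "x - z" "y - z"] by simp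
    then have "L * norm (x - y) \<le> L * norm (x - z) + L * norm (y - z)"
      using \<open>L \<ge> 0\<close> by (metis distrib_left mult_left_mono)
    then show "f y - L * norm (y - z) \<le> f x + L * norm (x - z)"
      using lip[OF that \<open>y \<in> X\<close>] by linarith
  qed
  obtain x\<^sub>0 where "x\<^sub>0 \<in> X" using \<open>X \<noteq> {}\<close> by blast
  then have "M \<ge> 0" using M by fastforce
  have "\<bar>max (-M) w - f x\<bar> \<le> L * norm (x - z)" if "x \<in> X" for x
  proof -
    have "0 \<le> L * norm (x - z)" using \<open>L \<ge> 0\<close> by simp
    then show ?thesis using lower[OF that] upper[OF that] M[OF that] by linarith
  qed
  moreover have "\<bar>max (-M) w\<bar> \<le> M" using \<open>w \<le> M\<close> \<open>M \<ge> 0\<close> by linarith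
  ultimately show ?thesis by blast
qed

text \<open>
  Each affine piece equals \<open>c |x|\<^sup>2 + w\<^sub>k - c |x - z\<^sub>k|\<^sup>2\<close>. So a piece exceeds \<open>c |x|\<^sup>2 + u\<close> by at most
  the maximum of \<open>l r - c r\<^sup>2\<close>, and the piece of a point within \<open>\<delta>\<close> of \<open>x\<close> falls short of it by at
  most \<open>l \<delta> + c \<delta>\<^sup>2\<close>.
\<close>
lemma penalised_max_close:
  fixes x :: "'a::real_inner" and z :: "nat \<Rightarrow> 'a"
  assumes w: "\<And>k. k \<in> {1..K} \<Longrightarrow> \<bar>w k - u\<bar> \<le> l * norm (x - z k)"
    and e: "\<And>k. k \<in> {1..K} \<Longrightarrow> l * norm (x - z k) - c * (norm (x - z k))\<^sup>2 \<le> e"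
    and near: "k\<^sub>0 \<in> {1..K}" "norm (x - z k\<^sub>0) \<le> \<delta>" and "l \<ge> 0" "c \<ge> 0"
  shows "(MAX k\<in>{1..K}. ((2 * c) *\<^sub>R z k) \<bullet> x + (w k - c * (norm (z k))\<^sup>2))
           \<in> {c * (norm x)\<^sup>2 + u - (l * \<delta> + c * \<delta>\<^sup>2) .. c * (norm x)\<^sup>2 + u + e}"
proof -
  define h where "h = (\<lambda>k. ((2 * c) *\<^sub>R z k) \<bullet> x + (w k - c * (norm (z k))\<^sup>2))"
  have h: "h k = c * (norm x)\<^sup>2 + w k - c * (norm (x - z k))\<^sup>2" for k
    by (simp add: h_def power2_norm_eq_inner inner_diff algebra_simps inner_commute)
  have "h k \<le> c * (norm x)\<^sup>2 + u + e" if "k \<in> {1..K}" for k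
    using w[OF that] e[OF that] h[of k] by linarith
  then have "(MAX k\<in>{1..K}. h k) \<le> c * (norm x)\<^sup>2 + u + e"
    using near(1) by (subst Max_le_iff) auto
  moreover have "c * (norm x)\<^sup>2 + u - (l * \<delta> + c * \<delta>\<^sup>2) \<le> h k\<^sub>0"
  proof -
    have "l * norm (x - z k\<^sub>0) \<le> l * \<delta>" "c * (norm (x - z k\<^sub>0))\<^sup>2 \<le> c * \<delta>\<^sup>2"
      using near(2) \<open>l \<ge> 0\<close> \<open>c \<ge> 0\<close> by (auto intro!: mult_left_mono power_mono)
    then show ?thesis using w[OF near(1)] h[of k\<^sub>0] by linarith
  qed
  then have "c * (norm x)\<^sup>2 + u - (l * \<delta> + c * \<delta>\<^sup>2) \<le> (MAX k\<in>{1..K}. h k)"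
    using near(1) by (intro order.trans[OF _ Max_ge]) auto
  ultimately show ?thesis by (simp add: h_def)
qed

lemma pw_affine_close:
  fixes x :: "real ^ 'p" and z :: "nat \<Rightarrow> real ^ 'p"
  assumes v: "\<And>k. k \<in> {1..K} \<Longrightarrow> \<bar>v k - u\<bar> \<le> L * norm (x - z k)"
    and e: "\<And>k. k \<in> {1..K} \<Longrightarrow> L / 2 * norm (x - z k) - c * (norm (x - z k))\<^sup>2 \<le> e"
    and near: "k\<^sub>0 \<in> {1..K}" "norm (x - z k\<^sub>0) \<le> \<delta>" and "L \<ge> 0" "c \<ge> 0"
  shows "\<bar>pw_affine K (\<lambda>k. ((2 * c) *\<^sub>R z k, v k / 2 - c * (norm (z k))\<^sup>2,
                            (2 * c) *\<^sub>R z k, - (v k / 2) - c * (norm (z k))\<^sup>2)) x - u\<bar>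
           \<le> e + (L / 2 * \<delta> + c * \<delta>\<^sup>2)"
proof -
  have half: "\<bar>v k / 2 - u / 2\<bar> \<le> L / 2 * norm (x - z k)"
    "\<bar>- (v k / 2) - - (u / 2)\<bar> \<le> L / 2 * norm (x - z k)" if "k \<in> {1..K}" for k
    using v[OF that] by linarith+
  have "L / 2 \<ge> 0" using \<open>L \<ge> 0\<close> by simp
  note close = penalised_max_close[where x = x and z = z and l = "L / 2" and c = c and K = K,
      OF _ e near this \<open>c \<ge> 0\<close>]
  show ?thesis
    using close[where w = "\<lambda>k. v k / 2" and u = "u / 2", OF half(1)]
      close[where w = "\<lambda>k. - (v k / 2)" and u = "- (u / 2)", OF half(2)]
    unfolding pw_affine_def atLeastAtMost_iff prod.case abs_le_iff by linarith
qed

text \<open>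
  With \<open>s = K\<^bsup>1/p\<^esup>\<close>, the curvature \<open>c = L s / (4 a)\<close> makes the slopes \<open>2 c z\<^sub>k\<close> as large as the bound
  \<open>L s / 2\<close> admits. For \<open>a = 0\<close> this formula gives \<open>c = 0\<close>, which is the right choice: the only
  point of \<open>X\<close> is then the origin, and a constant is exact there.
\<close>
theorem pw_affine_approximates_lipschitz:
  fixes X :: "(real ^ 'p) set" and f :: "real ^ 'p \<Rightarrow> real" and K :: nat
  defines "p \<equiv> real CARD('p)"
  defines "s \<equiv> real K powr (1 / p)"
  assumes "X \<noteq> {}" and X: "\<And>x. x \<in> X \<Longrightarrow> infnorm x \<le> a"
    and lip: "\<And>x y. x \<in> X \<Longrightarrow> y \<in> X \<Longrightarrow> \<bar>f x - f y\<bar> \<le> L * norm (x - y)"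
    and M: "\<And>x. x \<in> X \<Longrightarrow> \<bar>f x\<bar> \<le> M" and "L \<ge> 0" "K \<ge> 1"
    and \<mu>: "1 / 2 * L * s \<le> \<mu>" "1 / 4 * p * L * a * s + 1 / 2 * M \<le> \<mu>"
  shows "\<exists>\<theta>. param_norm K \<theta> \<le> \<mu> \<and>
    (\<forall>x\<in>X. \<bar>pw_affine K \<theta> x - f x\<bar> \<le> (1 / 4 + sqrt p + p) * (L * a / s))"
proof -
  have "s \<ge> 1"
    using \<open>K \<ge> 1\<close> by (simp add: s_def p_def ge_one_powr_ge_zero)
  have "a \<ge> 0"
    using X \<open>X \<noteq> {}\<close> infnorm_pos_le by (metis ex_in_conv order.trans)
  define \<delta> where "\<delta> = 2 * sqrt p * a / s"
  obtain z :: "nat \<Rightarrow> real ^ 'p" where z: "\<And>k. k \<in> {1..K} \<Longrightarrow> infnorm (z k) \<le> a"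
    and near: "\<And>x. infnorm x \<le> a \<Longrightarrow> \<exists>k\<in>{1..K}. norm (x - z k) \<le> \<delta>"
    using cube_net[OF \<open>K \<ge> 1\<close> \<open>a \<ge> 0\<close>, where 'p = 'p] unfolding \<delta>_def s_def p_def by metis
  have "\<exists>v. \<bar>v\<bar> \<le> M \<and> (\<forall>x\<in>X. \<bar>v - f x\<bar> \<le> L * norm (x - z k))" for k
    by (rule lipschitz_bounded_value[OF \<open>X \<noteq> {}\<close> lip M \<open>L \<ge> 0\<close>])
  then obtain v where v_M: "\<And>k. \<bar>v k\<bar> \<le> M"
    and v: "\<And>k x. x \<in> X \<Longrightarrow> \<bar>v k - f x\<bar> \<le> L * norm (x - z k)"
    by metis
  define c where "c = L * s / (4 * a)"
  have "c \<ge> 0"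
    using \<open>L \<ge> 0\<close> \<open>s \<ge> 1\<close> \<open>a \<ge> 0\<close> by (simp add: c_def)
  have ca: "c * a \<le> L * s / 4"
    using \<open>L \<ge> 0\<close> \<open>s \<ge> 1\<close> by (simp add: c_def)
  define \<theta> where "\<theta> = (\<lambda>k. ((2 * c) *\<^sub>R z k, v k / 2 - c * (norm (z k))\<^sup>2,
                              (2 * c) *\<^sub>R z k, - (v k / 2) - c * (norm (z k))\<^sup>2))"
  have "param_norm K \<theta> \<le> \<mu>"
    unfolding param_norm_le_iff[OF \<open>K \<ge> 1\<close>]
  proof
    fix k assume k: "k \<in> {1..K}"
    have "infnorm ((2 * c) *\<^sub>R z k) = 2 * (c * infnorm (z k))"
      using \<open>c \<ge> 0\<close> by (simp add: infnorm_mul)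
    also have "\<dots> \<le> 2 * (c * a)"
      using z[OF k] \<open>c \<ge> 0\<close> by (simp add: mult_left_mono)
    also have "\<dots> \<le> \<mu>" using ca \<mu>(1) by simp
    finally have slope: "infnorm ((2 * c) *\<^sub>R z k) \<le> \<mu>" .
    have "norm (z k) \<le> sqrt p * infnorm (z k)"
      using norm_le_infnorm[of "z k"] by (simp add: p_def)
    also have "\<dots> \<le> sqrt p * a"
      using z[OF k] by (simp add: p_def mult_left_mono)
    finally have "(norm (z k))\<^sup>2 \<le> (sqrt p * a)\<^sup>2"
      by (intro power_mono) auto
    then have "(norm (z k))\<^sup>2 \<le> p * a\<^sup>2"
      by (simp add: power_mult_distrib p_def)
    then have "c * (norm (z k))\<^sup>2 \<le> c * (p * a\<^sup>2)"
      using \<open>c \<ge> 0\<close> by (rule mult_left_mono)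
    also have "\<dots> = (p * a) * (c * a)"
      by (simp add: power2_eq_square)
    also have "\<dots> \<le> (p * a) * (L * s / 4)"
      using ca \<open>a \<ge> 0\<close> by (intro mult_left_mono) (auto simp: p_def)
    finally have "c * (norm (z k))\<^sup>2 \<le> 1 / 4 * p * L * a * s"
      by (simp add: mult_ac)
    moreover have "0 \<le> c * (norm (z k))\<^sup>2" using \<open>c \<ge> 0\<close> by simp
    ultimately have "v k / 2 - c * (norm (z k))\<^sup>2 \<in> {-\<mu>..\<mu>}"
      "- (v k / 2) - c * (norm (z k))\<^sup>2 \<in> {-\<mu>..\<mu>}"
      using v_M[of k] \<mu>(2) unfolding atLeastAtMost_iff by linarith+
    with slope show "\<theta> k \<in> {\<alpha>. infnorm \<alpha> \<le> \<mu>} \<times> {-\<mu>..\<mu>} \<times> {\<alpha>. infnorm \<alpha> \<le> \<mu>} \<times> {-\<mu>..\<mu>}"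
      by (simp add: \<theta>_def)
  qed
  moreover have "\<bar>pw_affine K \<theta> x - f x\<bar> \<le> (1 / 4 + sqrt p + p) * (L * a / s)" if "x \<in> X" for x
  proof -
    \<comment> \<open>Completing the square: \<open>l r - c r\<^sup>2\<close> is at most \<open>l\<^sup>2 / (4 c)\<close>, here with \<open>l = L / 2\<close>.\<close>
    have e: "L / 2 * norm (x - z k) - c * (norm (x - z k))\<^sup>2 \<le> 1 / 4 * (L * a / s)"
      if k: "k \<in> {1..K}" for k
    proof (cases "a = 0")
      case True
      then have "x = 0" "z k = 0"
        using X[OF \<open>x \<in> X\<close>] z[OF k] infnorm_pos_le infnorm_eq_0 by (metis order.antisym)+
      then show ?thesis using True by simp
    next
      case False
      define r where "r = norm (x - z k)"
      have "0 \<le> L / (4 * a * s) * (a - s * r)\<^sup>2"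
        using \<open>L \<ge> 0\<close> \<open>a \<ge> 0\<close> \<open>s \<ge> 1\<close> by simp
      also have "\<dots> = 1 / 4 * (L * a / s) - (L / 2 * r - c * r\<^sup>2)"
        using False \<open>s \<ge> 1\<close> by (simp add: c_def field_simps power2_eq_square)
      finally show ?thesis by (simp add: r_def)
    qed
    have "c * \<delta>\<^sup>2 = 4 * p * a * (c * a) / s\<^sup>2"
      by (simp add: \<delta>_def power2_eq_square p_def)
    also have "\<dots> \<le> 4 * p * a * (L * s / 4) / s\<^sup>2"
      using ca \<open>a \<ge> 0\<close> by (intro divide_right_mono mult_left_mono) (auto simp: p_def)
    also have "\<dots> = p * (L * a / s)"
      using \<open>s \<ge> 1\<close> by (simp add: power2_eq_square)
    finally have "c * \<delta>\<^sup>2 \<le> p * (L * a / s)" .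
    moreover have "L / 2 * \<delta> = sqrt p * (L * a / s)"
      by (simp add: \<delta>_def)
    moreover obtain k\<^sub>0 where "k\<^sub>0 \<in> {1..K}" "norm (x - z k\<^sub>0) \<le> \<delta>"
      using near[OF X[OF \<open>x \<in> X\<close>]] by blast
    from pw_affine_close[where v = v and u = "f x", OF v[OF \<open>x \<in> X\<close>] e this \<open>L \<ge> 0\<close> \<open>c \<ge> 0\<close>]
    have "\<bar>pw_affine K \<theta> x - f x\<bar> \<le> 1 / 4 * (L * a / s) + (L / 2 * \<delta> + c * \<delta>\<^sup>2)"
      by (simp add: \<theta>_def)
    ultimately show ?thesis
      unfolding distrib_right by linarith
  qed
  ultimately show ?thesis by blast
qed

section \<open>The approximation bound for vector-valued functions\<close>

theorem proposition1:
  fixes X :: "(real ^ 'p) set"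
    and f\<^sub>0 :: "real ^ 'p \<Rightarrow> real ^ 'd"
    and X_bar L\<^sub>0 M\<^sub>0 \<mu> :: real
    and K :: nat
  assumes "compact X"
    and "X_bar \<in> infnorm ` X"
    and "\<And>x. x \<in> X \<Longrightarrow> infnorm x \<le> X_bar"
    and "L\<^sub>0 > 0"
    and "M\<^sub>0 > 0"
    and "f\<^sub>0 \<in> lipschitz_class X L\<^sub>0 M\<^sub>0"
    and "K \<ge> 1"
    and "\<mu> \<ge> max (1 / 2 * L\<^sub>0 * real K powr (1 / real CARD('p)))
                 (1 / 4 * real CARD('p) * L\<^sub>0 * X_bar * real K powr (1 / real CARD('p))
                  + 1 / 2 * M\<^sub>0)"
  shows "\<exists>f \<in> pw_affine_class X K \<mu>.
           (\<forall>g \<in> pw_affine_class X K \<mu>.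
              sup_norm X (\<lambda>x. f x - f\<^sub>0 x) \<le> sup_norm X (\<lambda>x. g x - f\<^sub>0 x)) \<and>
           sup_norm X (\<lambda>x. f x - f\<^sub>0 x)
             \<le> 2 * (sqrt (real CARD('p)) + 3) * sqrt (real CARD('p)) * L\<^sub>0 * X_bar
                 * real K powr (- 1 / real CARD('p))"
proof -
  define p where "p = real CARD('p)"
  define s where "s = real K powr (1 / p)"
  define E where "E = (1 / 4 + sqrt p + p) * (L\<^sub>0 * X_bar / s)"
  have "X \<noteq> {}" and "X_bar \<ge> 0"
    using assms(2) by (auto simp: infnorm_pos_le)
  have lip: "L\<^sub>0-lipschitz_on X f\<^sub>0" and "sup_norm X f\<^sub>0 \<le> M\<^sub>0"
    using assms(6) by (auto simp: lipschitz_class_def)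
  then have cont: "continuous_on X f\<^sub>0"
    by (intro lipschitz_on_continuous_on)
  then have M: "\<bar>f\<^sub>0 x $ \<iota>\<bar> \<le> M\<^sub>0" if "x \<in> X" for x \<iota>
    using that \<open>sup_norm X f\<^sub>0 \<le> M\<^sub>0\<close> sup_norm_le_iff[OF \<open>compact X\<close> \<open>X \<noteq> {}\<close> cont] by blast
  have \<mu>: "1 / 2 * L\<^sub>0 * s \<le> \<mu>" "1 / 4 * p * L\<^sub>0 * X_bar * s + 1 / 2 * M\<^sub>0 \<le> \<mu>"
    using assms(8) by (auto simp: s_def p_def)
  have "s \<ge> 1" and "p \<ge> 1"
    using \<open>K \<ge> 1\<close> by (auto simp: s_def p_def ge_one_powr_ge_zero Suc_le_eq)
  have "0 \<le> 1 / 2 * L\<^sub>0 * s"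
    using \<open>L\<^sub>0 > 0\<close> \<open>s \<ge> 1\<close> by simp
  then have "\<mu> \<ge> 0" using \<mu>(1) by (rule order.trans)
  have "\<exists>\<theta>. param_norm K \<theta> \<le> \<mu> \<and> (\<forall>x\<in>X. \<bar>pw_affine K \<theta> x - f\<^sub>0 x $ \<iota>\<bar> \<le> E)" for \<iota>
    unfolding E_def s_def p_def
  proof (rule pw_affine_approximates_lipschitz)
    fix x y assume "x \<in> X" "y \<in> X"
    have "\<bar>f\<^sub>0 x $ \<iota> - f\<^sub>0 y $ \<iota>\<bar> \<le> norm (f\<^sub>0 x - f\<^sub>0 y)"
      by (metis component_le_norm_cart vector_minus_component)
    also have "\<dots> \<le> L\<^sub>0 * norm (x - y)"
      using lipschitz_onD[OF lip \<open>x \<in> X\<close> \<open>y \<in> X\<close>] by (simp add: dist_norm)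
    finally show "\<bar>f\<^sub>0 x $ \<iota> - f\<^sub>0 y $ \<iota>\<bar> \<le> L\<^sub>0 * norm (x - y)" .
  qed (use assms M \<mu> \<open>X \<noteq> {}\<close> in \<open>auto simp: s_def p_def\<close>)
  then obtain \<theta> where \<theta>: "\<And>\<iota>. param_norm K (\<theta> \<iota>) \<le> \<mu>"
    "\<And>\<iota> x. x \<in> X \<Longrightarrow> \<bar>pw_affine K (\<theta> \<iota>) x - f\<^sub>0 x $ \<iota>\<bar> \<le> E"
    by metis
  define g :: "real ^ 'p \<Rightarrow> real ^ 'd" where "g = (\<lambda>x. \<chi> \<iota>. pw_affine K (\<theta> \<iota>) x)"
  have "g \<in> pw_affine_class X K \<mu>"
    using \<theta>(1) by (auto simp: pw_affine_class_def g_def)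
  have "sup_norm X (\<lambda>x. g x - f\<^sub>0 x) \<le> E"
  proof -
    have "continuous_on X (\<lambda>x. g x - f\<^sub>0 x)"
      unfolding g_def
      by (intro continuous_on_diff cont continuous_on_vec_lambda continuous_on_pw_affine \<open>K \<ge> 1\<close>)
    from sup_norm_le_iff[OF \<open>compact X\<close> \<open>X \<noteq> {}\<close> this] show ?thesis
      using \<theta>(2) by (simp add: g_def)
  qed
  also have "E \<le> 2 * (sqrt p + 3) * sqrt p * (L\<^sub>0 * X_bar / s)"
    unfolding E_def
  proof (rule mult_right_mono)
    have "sqrt p \<ge> 1" "sqrt p * sqrt p = p" using \<open>p \<ge> 1\<close> by auto
    then show "1 / 4 + sqrt p + p \<le> 2 * (sqrt p + 3) * sqrt p"
      using \<open>p \<ge> 1\<close> unfolding distrib_right distrib_left mult.assoc by linarith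
    show "0 \<le> L\<^sub>0 * X_bar / s"
      using \<open>L\<^sub>0 > 0\<close> \<open>X_bar \<ge> 0\<close> \<open>s \<ge> 1\<close> by simp
  qed
  also have "\<dots> = 2 * (sqrt p + 3) * sqrt p * L\<^sub>0 * X_bar * real K powr (- 1 / p)"
    by (simp add: s_def powr_minus_divide)
  finally have bound: "sup_norm X (\<lambda>x. g x - f\<^sub>0 x) \<le> \<dots>" .
  obtain f where "f \<in> pw_affine_class X K \<mu>"
    and min: "\<And>g. g \<in> pw_affine_class X K \<mu> \<Longrightarrow>
           sup_norm X (\<lambda>x. f x - f\<^sub>0 x) \<le> sup_norm X (\<lambda>x. g x - f\<^sub>0 x)"
    using pw_affine_class_minimizer[OF \<open>compact X\<close> \<open>X \<noteq> {}\<close> cont \<open>K \<ge> 1\<close> \<open>\<mu> \<ge> 0\<close>] by blast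
  with order.trans[OF min[OF \<open>g \<in> pw_affine_class X K \<mu>\<close>] bound] show ?thesis
    unfolding p_def by blast
qed

end
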